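(* Let $n,k \in \mathbb{Z}^+$ be such that $k \geq 2n$. Then $$\mathcal{H}^{k+1} \left( \pi ( \mathcal{P}_{n,k+1} ) \cap \overline{B}_{k+1}(0,1) \right) > \mathcal{H}^{k+1} \left( \mathcal{P}_{n,k} \cap \overline{B}_{k+1} (0,1) \right).$$
   Context: For a positive integer $n$, let $\mathsf{M}_n^{\geq 0}$ denote the set of $n\times n$ real matrices with all entries nonnegative. Define $\mathcal{P}_n = \{ p \in \mathbb{R}[x] : p(A) \geq 0 \text{ for all } A \in \mathsf{M}_n^{\geq 0}\}$, where $p(A)\ge 0$ means that the matrix $p(A)$ is entrywise nonnegative, and $\mathcal{P}_{n,m} = \{ p \in \mathcal{P}_n : \deg(p) \leq m \}$ (the zero polynomial included). $\mathcal{P}_{n,k}$ is regarded as a subset of $\mathbb{R}^{k+1}$ by identifying a polynomial $\sum_{j=0}^k a_j x^j$ with its coefficient vector $(a_0,\dots,a_k)$. The map $\pi$ on $\mathcal{P}_{n,k+1}$ is the projection that drops the $x^{k+1}$ term: $\pi\left(\sum_{j=0}^{k+1} a_j x^j\right) = \sum_{j=0}^{k} a_j x^j$, viewed in $\mathbb{R}^{k+1}$. $\overline{B}_{k+1}(0,1)$ is the closed Euclidean unit ball in $\mathbb{R}^{k+1}$ centered at $0$, and $\mathcal{H}^{s}$ denotes $s$-dimensional Hausdorff measure. *)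

theory Defs
  imports "HOL-Analysis.Analysis" "Jordan_Normal_Form.Matrix"
begin

section \<open>Hausdorff measure\<close>

definition mdiam :: "'a metric \<Rightarrow> 'a set \<Rightarrow> ennreal" where
  "mdiam m U = (SUP x\<in>U. SUP y\<in>U. ennreal (mdist m x y))"

text \<open>The usual conventions \<open>(diam {})^s = 0\<close> and, for nonempty \<open>U\<close>, \<open>(diam U)^0 = 1\<close> are made
  explicit, because \<open>0 powr 0 = 0\<close>. The gauge is only applied to sets of finite diameter.\<close>

definition hausdorff_gauge :: "'a metric \<Rightarrow> real \<Rightarrow> 'a set \<Rightarrow> ennreal" where
  "hausdorff_gauge m s U =
     (if U = {} then 0 else if s = 0 then 1 else ennreal (enn2real (mdiam m U) powr s))"

definition hausdorff_premeasure :: "'a metric \<Rightarrow> real \<Rightarrow> real \<Rightarrow> 'a set \<Rightarrow> ennreal" where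
  "hausdorff_premeasure m s \<delta> S =
     (INF U \<in> {U :: nat \<Rightarrow> 'a set. S \<subseteq> (\<Union>i. U i) \<and>
                  (\<forall>i. U i \<subseteq> mspace m \<and> mdiam m (U i) \<le> ennreal \<delta>)}.
        \<Sum>i. hausdorff_gauge m s (U i))"

text \<open>No normalising factor \<open>\<pi>^(s/2) / (2^s \<Gamma>(s/2 + 1))\<close> is included. It would multiply all
  \<open>s\<close>-dimensional measures by the same positive real.\<close>

definition hausdorff_measure :: "'a metric \<Rightarrow> real \<Rightarrow> 'a set \<Rightarrow> ennreal" where
  "hausdorff_measure m s S = (SUP \<delta>\<in>{0<..}. hausdorff_premeasure m s \<delta> S)"

section \<open>Euclidean space of dimension \<open>d\<close> with its Euclidean distance\<close>

text \<open>Points are sequences vanishing from index \<open>d\<close> on, as in \<^const>\<open>Euclidean_space\<close>. Hence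
  \<open>coeff p\<close> is the coefficient vector of \<open>p\<close> in dimension \<open>k + 1\<close> whenever \<open>degree p \<le> k\<close>.\<close>

definition euclidean_space_metric :: "nat \<Rightarrow> (nat \<Rightarrow> real) metric" where
  "euclidean_space_metric d =
     metric (topspace (Euclidean_space d), \<lambda>x y. L2_set (\<lambda>i. x i - y i) {..<d})"

lemma Metric_space_euclidean:
  "Metric_space (topspace (Euclidean_space d)) (\<lambda>x y. L2_set (\<lambda>i. x i - y i) {..<d})"
proof
  fix x y z :: "nat \<Rightarrow> real"
  show "0 \<le> L2_set (\<lambda>i. x i - y i) {..<d}"
    by (rule L2_set_nonneg)
  show "L2_set (\<lambda>i. x i - y i) {..<d} = L2_set (\<lambda>i. y i - x i) {..<d}"
    by (simp add: L2_set_def power2_commute)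
  show "L2_set (\<lambda>i. x i - y i) {..<d} = 0 \<longleftrightarrow> x = y"
    if "x \<in> topspace (Euclidean_space d)" "y \<in> topspace (Euclidean_space d)"
    using that unfolding topspace_Euclidean_space
    by (auto simp: L2_set_eq_0_iff fun_eq_iff) (metis lessThan_iff linorder_not_less)
  show "L2_set (\<lambda>i. x i - z i) {..<d} \<le>
        L2_set (\<lambda>i. x i - y i) {..<d} + L2_set (\<lambda>i. y i - z i) {..<d}"
    using L2_set_triangle_ineq [of "\<lambda>i. x i - y i" "\<lambda>i. y i - z i" "{..<d}"] by simp
qed

lemma mspace_euclidean_space [simp]:
  "mspace (euclidean_space_metric d) = topspace (Euclidean_space d)"
  by (simp add: euclidean_space_metric_def Metric_space.mspace_metric [OF Metric_space_euclidean])

lemma mdist_euclidean_space_metric [simp]: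
  "mdist (euclidean_space_metric d) x y = L2_set (\<lambda>i. x i - y i) {..<d}"
  by (simp add: euclidean_space_metric_def Metric_space.mdist_metric [OF Metric_space_euclidean])

lemma coeff_in_Euclidean_space_iff:
  fixes p :: "real poly"
  shows "coeff p \<in> topspace (Euclidean_space (Suc k)) \<longleftrightarrow> degree p \<le> k"
  by (auto simp: topspace_Euclidean_space Suc_le_eq coeff_eq_0 intro: degree_le)

section \<open>Polynomials preserving nonnegative matrices\<close>

definition poly_mat :: "real poly \<Rightarrow> real mat \<Rightarrow> real mat" where
  "poly_mat p A = Matrix.mat (dim_row A) (dim_row A)
     (\<lambda>ij. \<Sum>l\<le>degree p. coeff p l * (A ^\<^sub>m l) $$ ij)"

text \<open>The order on matrices is entrywise.\<close>

definition nonneg_mats :: "nat \<Rightarrow> real mat set" where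
  "nonneg_mats n = {A \<in> carrier_mat n n. 0\<^sub>m n n \<le> A}"

definition nonneg_preserving :: "nat \<Rightarrow> real poly set" where
  "nonneg_preserving n = {p. \<forall>A \<in> nonneg_mats n. 0\<^sub>m n n \<le> poly_mat p A}"

definition nonneg_preserving_deg :: "nat \<Rightarrow> nat \<Rightarrow> real poly set" where
  "nonneg_preserving_deg n m = {p \<in> nonneg_preserving n. degree p \<le> m}"

definition drop_term :: "nat \<Rightarrow> real poly \<Rightarrow> real poly" where
  "drop_term m p = p - monom (coeff p m) m"

end

theory Submission
  imports Defs
begin

text \<open>
  Put \<open>m = k + 1 - n\<close>. A polynomial of degree at most \<open>k\<close> that preserves nonnegativity of \<open>n \<times> n\<close>
  matrices cannot have a negative coefficient at \<open>x ^ m\<close>, because \<open>m\<close> is one of the top \<open>n\<close> exponents: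
  evaluating at large multiples of a cyclic permutation matrix isolates the exponents in a residue class
  modulo \<open>n\<close>, and \<open>m\<close> is the largest in its class (\<open>coeff_nonneg_if_nonneg_preserving\<close>). In degree
  \<open>k + 1 = m + n\<close> there is one more exponent on top, and this obstruction disappears.

  In fact every coefficient vector whose entry at \<open>m\<close> is negative but small compared with all the other
  entries, which are positive, can be completed by a coefficient at \<open>x ^ (k + 1)\<close> to a polynomial that
  preserves nonnegativity. The reason is combinatorial. The entries of \<open>A ^ m\<close> are sums over walks of
  length \<open>m\<close>; since \<open>m \<ge> n\<close>, such a walk contains a cycle of length \<open>c \<le> n\<close>, and removing the cycle
  or doubling it gives walks of lengths \<open>m - c\<close> and \<open>m + c\<close> whose weights have the weight of the original
  walk as geometric mean. Hence \<open>A ^ m\<close> is dominated, entry by entry, by lower and higher powers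
  (\<open>pow_mat_le_neighbours\<close>), and their terms absorb the negative one
  (\<open>nonneg_preserving_with_negative_coeff\<close>).

  So the projected cone contains a small cube inside the unit ball on which coordinate \<open>m\<close> is at most
  some \<open>- \<eta> < 0\<close>, at distance at least \<open>\<eta>\<close> from the smaller cone. Hausdorff measure is superadditive on
  sets at positive distance (\<open>hausdorff_measure_separated\<close>). The smaller set has finite measure
  (\<open>hausdorff_measure_unit_cube_finite\<close>) and the cube has positive measure
  (\<open>hausdorff_measure_cube_pos\<close>), so adding the cube strictly increases the measure.
\<close>

section \<open>Entries of matrix powers\<close>

lemma pow_mat_add:
  fixes A :: "'a :: semiring_1 mat"
  assumes "A \<in> carrier_mat n n"
  shows "A ^\<^sub>m (a + b) = A ^\<^sub>m a * A ^\<^sub>m b"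
proof (induction b)
  case 0
  then show ?case using assms by simp
next
  case (Suc b)
  then show ?case
    using assms by (simp add: assoc_mult_mat [of _ n n _ n _ n])
qed

lemma nonneg_mats_carrier: "A \<in> nonneg_mats n \<Longrightarrow> A \<in> carrier_mat n n"
  by (simp add: nonneg_mats_def)

lemma zero_le_mat_iff:
  fixes B :: "'a :: {zero, ord} mat"
  assumes "B \<in> carrier_mat n n"
  shows "0\<^sub>m n n \<le> B \<longleftrightarrow> (\<forall>i<n. \<forall>j<n. 0 \<le> B $$ (i, j))"
  unfolding less_eq_mat_def carrier_matD [OF assms] by simp

lemma nonneg_mats_iff:
  "A \<in> nonneg_mats n \<longleftrightarrow> A \<in> carrier_mat n n \<and> (\<forall>i<n. \<forall>j<n. 0 \<le> A $$ (i, j))"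
  using zero_le_mat_iff [of A n] by (simp add: nonneg_mats_def cong: conj_cong)

lemma pow_mat_index_add:
  fixes A :: "'a :: semiring_1 mat"
  assumes "A \<in> carrier_mat n n" "i < n" "j < n"
  shows "(A ^\<^sub>m (a + b)) $$ (i, j) = (\<Sum>h<n. (A ^\<^sub>m a) $$ (i, h) * (A ^\<^sub>m b) $$ (h, j))"
  using assms
  by (subst pow_mat_add [OF assms(1)]) (simp add: scalar_prod_def atLeast0LessThan)

lemma pow_mat_index_Suc:
  fixes A :: "'a :: semiring_1 mat"
  assumes "A \<in> carrier_mat n n" "i < n" "j < n"
  shows "(A ^\<^sub>m Suc a) $$ (i, j) = (\<Sum>h<n. (A ^\<^sub>m a) $$ (i, h) * A $$ (h, j))"
  using assms by (simp add: scalar_prod_def atLeast0LessThan)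

lemma pow_mat_index_nonneg:
  assumes "A \<in> nonneg_mats n" "i < n" "j < n"
  shows "0 \<le> (A ^\<^sub>m l) $$ (i, j)"
  using assms
proof (induction l arbitrary: j)
  case 0
  then show ?case by (auto simp: nonneg_mats_iff)
next
  case (Suc l)
  show ?case
    unfolding pow_mat_index_Suc [OF nonneg_mats_carrier [OF Suc.prems(1)] Suc.prems(2,3)]
    using Suc.prems by (intro sum_nonneg mult_nonneg_nonneg Suc.IH) (auto simp: nonneg_mats_iff)
qed

lemma pow_mat_index_mult_le:
  assumes A: "A \<in> nonneg_mats n" and "i < n" "j < n" "h < n"
  shows "(A ^\<^sub>m a) $$ (i, h) * (A ^\<^sub>m b) $$ (h, j) \<le> (A ^\<^sub>m (a + b)) $$ (i, j)"
  unfolding pow_mat_index_add [OF nonneg_mats_carrier [OF A] assms(2,3)]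
  using assms
  by (intro member_le_sum [where f = "\<lambda>h. (A ^\<^sub>m a) $$ (i, h) * (A ^\<^sub>m b) $$ (h, j)"])
     (auto intro!: mult_nonneg_nonneg pow_mat_index_nonneg)

section \<open>Walks and entries of powers\<close>

definition walk_weight :: "real mat \<Rightarrow> (nat \<Rightarrow> nat) \<Rightarrow> nat \<Rightarrow> nat \<Rightarrow> real" where
  "walk_weight A f s t = (\<Prod>u=s..<t. A $$ (f u, f (Suc u)))"

lemma walk_weight_nonneg:
  assumes "A \<in> nonneg_mats n" "\<And>u. f u < n"
  shows "0 \<le> walk_weight A f s t"
  using assms by (auto simp: walk_weight_def nonneg_mats_iff intro!: prod_nonneg)

lemma walk_weight_split:
  "s \<le> t \<Longrightarrow> t \<le> r \<Longrightarrow> walk_weight A f s r = walk_weight A f s t * walk_weight A f t r"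
  by (simp add: walk_weight_def prod.atLeastLessThan_concat)

lemma walk_weight_le_pow_mat:
  assumes A: "A \<in> nonneg_mats n" and f: "\<And>u. f u < n" and "s \<le> t"
  shows "walk_weight A f s t \<le> (A ^\<^sub>m (t - s)) $$ (f s, f t)"
  using \<open>s \<le> t\<close>
proof (induction t rule: dec_induct)
  case base
  then show ?case using nonneg_mats_carrier [OF A] f by (simp add: walk_weight_def)
next
  case (step t)
  have "walk_weight A f s (Suc t) = walk_weight A f s t * A $$ (f t, f (Suc t))"
    using step.hyps by (simp add: walk_weight_def)
  also have "\<dots> \<le> (A ^\<^sub>m (t - s)) $$ (f s, f t) * A $$ (f t, f (Suc t))"
    using step.IH A f by (intro mult_right_mono) (auto simp: nonneg_mats_iff)
  also have "\<dots> \<le> (A ^\<^sub>m (Suc t - s)) $$ (f s, f (Suc t))"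
    using pow_mat_index_mult_le [OF A f f f, of "t - s" s t 1 "Suc t"] step.hyps
      nonneg_mats_carrier [OF A]
    by (simp add: Suc_diff_le del: pow_mat.simps(2)) (simp)
  finally show ?case .
qed

text \<open>An entry of a power is the sum of the weights of at most \<open>n ^ l\<close> walks, so a walk of maximal weight
  satisfies the bound. The walk is built one step at a time, keeping the largest summand of
  the matrix product. Positivity of the entry is needed for a walk from \<open>i\<close> to \<open>j\<close> to exist: for
  \<open>l = 0\<close> there is none unless \<open>i = j\<close>. Walks are total functions; only their values up to \<open>l\<close> matter.\<close>

lemma pow_mat_le_walk_weight:
  assumes A: "A \<in> nonneg_mats n" and "i < n" "j < n" and "0 < (A ^\<^sub>m l) $$ (i, j)"
  shows "\<exists>f. (\<forall>u. f u < n) \<and> f 0 = i \<and> f l = j \<and>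
             (A ^\<^sub>m l) $$ (i, j) \<le> real n ^ l * walk_weight A f 0 l"
  using assms(3,4)
proof (induction l arbitrary: j)
  case 0
  have "i = j" using 0 assms(2) nonneg_mats_carrier [OF A] by (auto split: if_splits)
  then show ?case
    using 0 assms(2) nonneg_mats_carrier [OF A]
    by (intro exI [of _ "\<lambda>_. i"]) (auto simp: walk_weight_def)
next
  case (Suc l)
  let ?g = "\<lambda>h. (A ^\<^sub>m l) $$ (i, h) * A $$ (h, j)"
  have "{..<n} \<noteq> {}" using Suc.prems by auto
  then have "Max (?g ` {..<n}) \<in> ?g ` {..<n}" by (intro Max_in) auto
  then obtain h where h: "h < n" "Max (?g ` {..<n}) = ?g h" by auto
  have max: "?g h' \<le> ?g h" if "h' < n" for h'
    unfolding h(2) [symmetric] using that by (intro Max_ge) auto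
  have eq: "(A ^\<^sub>m Suc l) $$ (i, j) = (\<Sum>h<n. ?g h)"
    using pow_mat_index_Suc [OF nonneg_mats_carrier [OF A] assms(2) Suc.prems(1)] .
  also have "\<dots> \<le> real n * ?g h"
    using sum_bounded_above [of "{..<n}" ?g "?g h"] max by simp
  finally have le: "(A ^\<^sub>m Suc l) $$ (i, j) \<le> real n * ?g h" .
  have nonneg: "0 \<le> A $$ (h, j)" "0 \<le> (A ^\<^sub>m l) $$ (i, h)"
    using A h(1) Suc.prems(1) pow_mat_index_nonneg [OF A assms(2) h(1)]
    by (auto simp: nonneg_mats_iff)
  have "0 < (A ^\<^sub>m l) $$ (i, h)"
    using le Suc.prems(2) nonneg by (cases "(A ^\<^sub>m l) $$ (i, h) = 0") auto
  from Suc.IH [OF h(1) this] obtain f where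
    f: "\<And>u. f u < n" "f 0 = i" "f l = h"
      "(A ^\<^sub>m l) $$ (i, h) \<le> real n ^ l * walk_weight A f 0 l" by auto
  define f' where "f' = f(Suc l := j)"
  have ww: "walk_weight A f' 0 (Suc l) = walk_weight A f 0 l * A $$ (h, j)"
    unfolding walk_weight_def prod.atLeast0_lessThan_Suc
    using f(3) by (intro arg_cong2 [where f = "(*)"] prod.cong) (auto simp: f'_def)
  have "(A ^\<^sub>m Suc l) $$ (i, j) \<le> real n * ((real n ^ l * walk_weight A f 0 l) * A $$ (h, j))"
    using le f(4) nonneg(1)
    by (meson mult_left_mono mult_right_mono of_nat_0_le_iff order_trans)
  also have "\<dots> = real n ^ Suc l * walk_weight A f' 0 (Suc l)"
    by (simp add: ww)
  finally have le': "(A ^\<^sub>m Suc l) $$ (i, j) \<le> real n ^ Suc l * walk_weight A f' 0 (Suc l)" .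
  show ?case
  proof (intro exI [of _ f'] conjI allI)
    show "f' u < n" for u using f(1) Suc.prems(1) by (simp add: f'_def)
    show "f' 0 = i" "f' (Suc l) = j" using f(2) by (simp_all add: f'_def)
  qed (rule le')
qed

text \<open>A heaviest walk of length \<open>m \<ge> n\<close> visits more vertices than there are, so it splits as \<open>X C Y\<close>
  with \<open>C\<close> a closed walk of some length \<open>c \<le> n\<close>. Omitting \<open>C\<close> and traversing it twice give walks of
  lengths \<open>m - c\<close> and \<open>m + c\<close> with the same ends, whose weights \<open>XY\<close> and \<open>XCCY\<close> have geometric
  mean \<open>XCY\<close>. The arithmetic-geometric mean inequality then bounds \<open>XCY\<close>, and the factor \<open>n ^ m\<close>
  accounts for the number of walks. The exponent \<open>c\<close> depends on the matrix and on the entry.\<close>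

lemma pow_mat_le_neighbours:
  assumes A: "A \<in> nonneg_mats n" and i: "i < n" and j: "j < n" and m: "n \<le> m"
  shows "\<exists>c\<in>{1..n}. 2 * (A ^\<^sub>m m) $$ (i, j) \<le>
           real n ^ m * ((A ^\<^sub>m (m - c)) $$ (i, j) + (A ^\<^sub>m (m + c)) $$ (i, j))"
proof (cases "(A ^\<^sub>m m) $$ (i, j) = 0")
  case True
  then show ?thesis
    using i pow_mat_index_nonneg [OF A i j, of "m - 1"] pow_mat_index_nonneg [OF A i j, of "m + 1"]
    by (intro bexI [of _ 1]) (auto intro!: mult_nonneg_nonneg simp del: pow_mat.simps)
next
  case False
  then have "0 < (A ^\<^sub>m m) $$ (i, j)"
    using pow_mat_index_nonneg [OF A i j, of m] by linarith
  from pow_mat_le_walk_weight [OF A i j this] obtain f where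
    f: "\<And>u. f u < n" "f 0 = i" "f m = j"
      "(A ^\<^sub>m m) $$ (i, j) \<le> real n ^ m * walk_weight A f 0 m" by auto
  \<comment> \<open>The first \<open>n + 1\<close> vertices already contain a repetition, so the cycle has length at most \<open>n\<close>.\<close>
  have "card (f ` {..n}) < card {..n}"
    using card_mono [of "{..<n}" "f ` {..n}"] f(1) by (auto simp: image_subset_iff)
  then have "\<not> inj_on f {..n}" by (rule pigeonhole)
  then obtain s t where st: "s < t" "t \<le> n" "f s = f t"
    unfolding inj_on_def by (metis atMost_iff linorder_neqE_nat)
  define X where "X = walk_weight A f 0 s"
  define C where "C = walk_weight A f s t"
  define Y where "Y = walk_weight A f t m"
  have nonneg: "0 \<le> X" "0 \<le> C" "0 \<le> Y"
    using walk_weight_nonneg [OF A, of f] f(1) by (auto simp: X_def C_def Y_def)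
  have XCY: "walk_weight A f 0 m = X * C * Y"
    using st m walk_weight_split [of 0 t m A f] walk_weight_split [of 0 s t A f]
    by (simp add: X_def C_def Y_def)
  have X: "X \<le> (A ^\<^sub>m s) $$ (i, f s)"
    using walk_weight_le_pow_mat [OF A, of f 0 s] f(1) f(2) by (simp add: X_def)
  have C: "C \<le> (A ^\<^sub>m (t - s)) $$ (f s, f s)"
    using walk_weight_le_pow_mat [OF A, of f s t] f(1) st by (simp add: C_def)
  have Y: "Y \<le> (A ^\<^sub>m (m - t)) $$ (f s, j)"
    using walk_weight_le_pow_mat [OF A, of f t m] f(1) st m f(3) by (simp add: Y_def)
  have "X * Y \<le> (A ^\<^sub>m s) $$ (i, f s) * (A ^\<^sub>m (m - t)) $$ (f s, j)"
    using X Y nonneg pow_mat_index_nonneg [OF A i f(1)] by (intro mult_mono) auto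
  also have "\<dots> \<le> (A ^\<^sub>m (s + (m - t))) $$ (i, j)"
    by (rule pow_mat_index_mult_le [OF A i j f(1)])
  also have "s + (m - t) = m - (t - s)" using st m by simp
  finally have XY: "X * Y \<le> (A ^\<^sub>m (m - (t - s))) $$ (i, j)" .
  have "X * C \<le> (A ^\<^sub>m s) $$ (i, f s) * (A ^\<^sub>m (t - s)) $$ (f s, f s)"
    using X C nonneg pow_mat_index_nonneg [OF A i f(1)] by (intro mult_mono) auto
  also have "\<dots> \<le> (A ^\<^sub>m (s + (t - s))) $$ (i, f s)"
    by (rule pow_mat_index_mult_le [OF A i f(1) f(1)])
  finally have XC: "X * C \<le> (A ^\<^sub>m t) $$ (i, f s)" using st by simp
  have "X * C * C \<le> (A ^\<^sub>m t) $$ (i, f s) * (A ^\<^sub>m (t - s)) $$ (f s, f s)"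
    using XC C nonneg pow_mat_index_nonneg [OF A i f(1)] by (intro mult_mono) auto
  also have "\<dots> \<le> (A ^\<^sub>m (t + (t - s))) $$ (i, f s)"
    by (rule pow_mat_index_mult_le [OF A i f(1) f(1)])
  finally have XCC: "X * C * C \<le> (A ^\<^sub>m (t + (t - s))) $$ (i, f s)" .
  have "X * C * C * Y \<le> (A ^\<^sub>m (t + (t - s))) $$ (i, f s) * (A ^\<^sub>m (m - t)) $$ (f s, j)"
    using XCC Y nonneg pow_mat_index_nonneg [OF A i f(1)] by (intro mult_mono) auto
  also have "\<dots> \<le> (A ^\<^sub>m (t + (t - s) + (m - t))) $$ (i, j)"
    by (rule pow_mat_index_mult_le [OF A i j f(1)])
  also have "t + (t - s) + (m - t) = m + (t - s)" using st m by simp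
  finally have XCCY: "X * C * C * Y \<le> (A ^\<^sub>m (m + (t - s))) $$ (i, j)" .
  have "X * Y + X * C * C * Y - 2 * (X * C * Y) = X * Y * (1 - C)\<^sup>2"
    by (simp add: power2_eq_square algebra_simps)
  moreover have "0 \<le> X * Y * (1 - C)\<^sup>2" using nonneg by simp
  ultimately have "2 * (X * C * Y) \<le>
      (A ^\<^sub>m (m - (t - s))) $$ (i, j) + (A ^\<^sub>m (m + (t - s))) $$ (i, j)"
    using XY XCCY by linarith
  then have "real n ^ m * (2 * (X * C * Y)) \<le> real n ^ m *
      ((A ^\<^sub>m (m - (t - s))) $$ (i, j) + (A ^\<^sub>m (m + (t - s))) $$ (i, j))"
    by (intro mult_left_mono) auto
  with f(4) have "2 * (A ^\<^sub>m m) $$ (i, j) \<le> real n ^ m *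
      ((A ^\<^sub>m (m - (t - s))) $$ (i, j) + (A ^\<^sub>m (m + (t - s))) $$ (i, j))"
    unfolding XCY by linarith
  then show ?thesis using st by (intro bexI [of _ "t - s"]) auto
qed

section \<open>Which coefficients may be negative\<close>

text \<open>The sum may run up to any bound on the degree; this lets one formula serve for polynomials whose
  leading coefficients vanish.\<close>

lemma poly_mat_index:
  assumes "A \<in> carrier_mat n n" "i < n" "j < n" "degree p \<le> k"
  shows "poly_mat p A $$ (i, j) = (\<Sum>l\<le>k. coeff p l * (A ^\<^sub>m l) $$ (i, j))"
proof -
  have "poly_mat p A $$ (i, j) = (\<Sum>l\<le>degree p. coeff p l * (A ^\<^sub>m l) $$ (i, j))"
    using assms by (simp add: poly_mat_def)
  also have "\<dots> = (\<Sum>l\<le>k. coeff p l * (A ^\<^sub>m l) $$ (i, j))"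
    using assms(4) by (intro sum.mono_neutral_left) (auto simp: coeff_eq_0)
  finally show ?thesis .
qed

lemma nonneg_preserving_iff:
  "p \<in> nonneg_preserving n \<longleftrightarrow>
     (\<forall>A\<in>nonneg_mats n. \<forall>i<n. \<forall>j<n. 0 \<le> poly_mat p A $$ (i, j))"
proof -
  have "0\<^sub>m n n \<le> poly_mat p A \<longleftrightarrow> (\<forall>i<n. \<forall>j<n. 0 \<le> poly_mat p A $$ (i, j))"
    if "A \<in> nonneg_mats n" for A
    using nonneg_mats_carrier [OF that] by (intro zero_le_mat_iff) (simp add: poly_mat_def)
  then show ?thesis by (simp add: nonneg_preserving_def)
qed

text \<open>A coefficient with \<open>n\<close> large coefficients above it and \<open>n\<close> below it may be slightly
  negative: whichever cycle length \<open>c\<close> occurs, the terms of degrees \<open>m - c\<close> and \<open>m + c\<close>, both different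
  from \<open>m\<close>, compensate for the term of degree \<open>m\<close>. The bound on the negative coefficient depends on
  \<open>n\<close>, \<open>m\<close> and \<open>b\<close> only, hence it describes an open set of coefficient vectors.\<close>

lemma nonneg_preserving_with_negative_coeff:
  fixes p :: "real poly"
  assumes deg: "degree p \<le> m + n" and m: "n \<le> m" and b: "0 \<le> b"
    and large: "\<And>l. l \<le> m + n \<Longrightarrow> l \<noteq> m \<Longrightarrow> b \<le> coeff p l"
    and small: "- 2 * b \<le> coeff p m * real n ^ m"
  shows "p \<in> nonneg_preserving n"
  unfolding nonneg_preserving_iff
proof (intro ballI allI impI)
  fix A i j
  assume A: "A \<in> nonneg_mats n" and i: "i < n" and j: "j < n"
  define e where "e = (\<lambda>l. (A ^\<^sub>m l) $$ (i, j))"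
  have e: "0 \<le> e l" for l
    using pow_mat_index_nonneg [OF A i j] by (simp add: e_def)
  obtain c where c: "1 \<le> c" "c \<le> n" "2 * e m \<le> real n ^ m * (e (m - c) + e (m + c))"
    using pow_mat_le_neighbours [OF A i j m] by (auto simp: e_def)
  have n: "0 < real n ^ m" using i by simp
  have "- 2 * b * e m \<le> coeff p m * real n ^ m * e m"
    using small e by (rule mult_right_mono)
  moreover have "b * (2 * e m) \<le> b * (real n ^ m * (e (m - c) + e (m + c)))"
    using c(3) b by (rule mult_left_mono)
  ultimately have "0 \<le> real n ^ m * (coeff p m * e m + b * e (m - c) + b * e (m + c))"
    by (simp add: algebra_simps)
  then have "0 \<le> coeff p m * e m + b * e (m - c) + b * e (m + c)"
    using n by (simp add: zero_le_mult_iff)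
  also have "\<dots> \<le> coeff p m * e m + coeff p (m - c) * e (m - c) + coeff p (m + c) * e (m + c)"
    using large [of "m - c"] large [of "m + c"] c m e
    by (intro add_mono mult_right_mono) auto
  also have "\<dots> = (\<Sum>l\<in>{m, m - c, m + c}. coeff p l * e l)"
    using c m by simp
  also have "\<dots> \<le> (\<Sum>l\<le>m + n. coeff p l * e l)"
    using c b large e by (intro sum_mono2) (auto intro!: mult_nonneg_nonneg intro: order_trans [OF b])
  also have "\<dots> = poly_mat p A $$ (i, j)"
    using poly_mat_index [OF nonneg_mats_carrier [OF A] i j deg] by (simp add: e_def)
  finally show "0 \<le> poly_mat p A $$ (i, j)" .
qed

definition cyclic_mat :: "nat \<Rightarrow> real \<Rightarrow> real mat" where
  "cyclic_mat n t = Matrix.mat n n (\<lambda>(i, j). if j = Suc i mod n then t else 0)"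

lemma cyclic_mat_carrier [simp]: "cyclic_mat n t \<in> carrier_mat n n"
  by (simp add: cyclic_mat_def)

lemma pow_cyclic_mat:
  assumes "i < n" "j < n"
  shows "(cyclic_mat n t ^\<^sub>m l) $$ (i, j) = (if j = (i + l) mod n then t ^ l else 0)"
  using assms
proof (induction l arbitrary: j)
  case 0
  then show ?case by (auto simp: cyclic_mat_def)
next
  case (Suc l)
  have "(cyclic_mat n t ^\<^sub>m Suc l) $$ (i, j) =
      (\<Sum>h<n. (if h = (i + l) mod n then t ^ l else 0) * (if j = Suc h mod n then t else 0))"
    unfolding pow_mat_index_Suc [OF cyclic_mat_carrier Suc.prems]
    using Suc by (intro sum.cong) (auto simp: cyclic_mat_def)
  also have "\<dots> = (\<Sum>h<n. if h = (i + l) mod n then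
      t ^ l * (if j = Suc ((i + l) mod n) mod n then t else 0) else 0)"
    by (intro sum.cong) auto
  also have "\<dots> = t ^ l * (if j = Suc ((i + l) mod n) mod n then t else 0)"
    using Suc.prems by (simp add: sum.delta)
  also have "\<dots> = (if j = (i + Suc l) mod n then t ^ Suc l else 0)"
    by (auto simp: mod_simps)
  finally show ?case .
qed

text \<open>In the powers of \<open>t\<close> times a cyclic permutation matrix, the entry in position \<open>(0, m mod n)\<close> vanishes
  unless the exponent is congruent to \<open>m\<close> modulo \<open>n\<close>. So this entry of \<open>p\<close> is a polynomial in \<open>t\<close> in
  which only those coefficients of \<open>p\<close> survive. Among the exponents up to \<open>k < m + n\<close> the largest
  such exponent is \<open>m\<close>, and letting \<open>t\<close> grow shows that its coefficient is not negative.\<close>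

lemma coeff_nonneg_if_nonneg_preserving:
  fixes p :: "real poly"
  assumes n: "0 < n" and p: "p \<in> nonneg_preserving n"
    and deg: "degree p \<le> k" and m: "m \<le> k" "k < m + n"
  shows "0 \<le> coeff p m"
proof (rule ccontr)
  assume "\<not> 0 \<le> coeff p m"
  then have neg: "coeff p m < 0" by simp
  define S where "S = {l. l < m \<and> l mod n = m mod n}"
  have fin: "finite S" unfolding S_def by simp
  define B where "B = (\<Sum>l\<in>S. \<bar>coeff p l\<bar>)"
  have "0 \<le> B" unfolding B_def by (intro sum_nonneg) auto
  \<comment> \<open>At this \<open>t\<close> the term of degree \<open>m\<close> outweighs all lower ones, because \<open>coeff p m * t + B = coeff p m\<close>.\<close>
  define t where "t = 1 + B / - coeff p m"
  have t1: "1 \<le> t" using neg \<open>0 \<le> B\<close> by (simp add: t_def divide_nonneg_neg divide_le_0_iff)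
  have "cyclic_mat n t \<in> nonneg_mats n"
    using t1 by (auto simp: nonneg_mats_iff) (auto simp: cyclic_mat_def)
  then have "0 \<le> poly_mat p (cyclic_mat n t) $$ (0, m mod n)"
    using p n unfolding nonneg_preserving_iff by auto
  also have "\<dots> = (\<Sum>l\<le>k. coeff p l * (cyclic_mat n t ^\<^sub>m l) $$ (0, m mod n))"
    using n deg by (intro poly_mat_index) auto
  also have "\<dots> = (\<Sum>l\<le>k. coeff p l * (if m mod n = l mod n then t ^ l else 0))"
    using n by (intro sum.cong) (auto simp: pow_cyclic_mat)
  also have "\<dots> = (\<Sum>l\<in>insert m S. coeff p l * t ^ l)"
  proof (rule sum.mono_neutral_cong_right)
    show "insert m S \<subseteq> {..k}" using m by (auto simp: S_def)
    show "\<forall>l\<in>{..k} - insert m S. coeff p l * (if m mod n = l mod n then t ^ l else 0) = 0"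
    proof
      fix l assume l: "l \<in> {..k} - insert m S"
      have "m mod n \<noteq> l mod n"
      proof
        assume eq: "m mod n = l mod n"
        then have "m < l" using l by (auto simp: S_def)
        moreover have "n dvd l - m" using eq \<open>m < l\<close> mod_eq_dvd_iff_nat [of m l n] by simp
        ultimately have "n \<le> l - m" by (intro dvd_imp_le) auto
        then show False using l m by auto
      qed
      then show "coeff p l * (if m mod n = l mod n then t ^ l else 0) = 0" by simp
    qed
  qed (auto simp: S_def)
  also have "\<dots> = coeff p m * t ^ m + (\<Sum>l\<in>S. coeff p l * t ^ l)"
    using fin by (subst sum.insert) (auto simp: S_def)
  finally have "0 \<le> t * (coeff p m * t ^ m + (\<Sum>l\<in>S. coeff p l * t ^ l))"
    using t1 by (intro mult_nonneg_nonneg) auto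
  also have "\<dots> = coeff p m * t * t ^ m + (\<Sum>l\<in>S. coeff p l * t ^ Suc l)"
    by (simp add: algebra_simps sum_distrib_left)
  also have "\<dots> \<le> coeff p m * t * t ^ m + (\<Sum>l\<in>S. \<bar>coeff p l\<bar> * t ^ m)"
  proof (intro add_left_mono sum_mono)
    fix l assume "l \<in> S"
    then have "t ^ Suc l \<le> t ^ m" using t1 by (intro power_increasing) (auto simp: S_def)
    then show "coeff p l * t ^ Suc l \<le> \<bar>coeff p l\<bar> * t ^ m"
      using t1 by (intro mult_mono) auto
  qed
  also have "\<dots> = (coeff p m * t + B) * t ^ m"
    by (simp add: B_def sum_distrib_right distrib_right)
  also have "coeff p m * t + B = coeff p m"
    using neg by (simp add: t_def field_simps)
  finally have "0 \<le> coeff p m * t ^ m" .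
  moreover have "coeff p m * t ^ m < 0" using neg t1 by (intro mult_neg_pos zero_less_power) auto
  ultimately show False by simp
qed

section \<open>Hausdorff measure of separated sets\<close>

lemma mdiam_le_iff: "mdiam m U \<le> c \<longleftrightarrow> (\<forall>x\<in>U. \<forall>y\<in>U. ennreal (mdist m x y) \<le> c)"
  by (simp add: mdiam_def SUP_le_iff)

lemma hausdorff_gauge_empty [simp]: "hausdorff_gauge m s {} = 0"
  by (simp add: hausdorff_gauge_def)

lemma hausdorff_premeasure_mono:
  assumes "S \<subseteq> T"
  shows "hausdorff_premeasure m s \<delta> S \<le> hausdorff_premeasure m s \<delta> T"
  unfolding hausdorff_premeasure_def using assms by (intro INF_superset_mono) auto

lemma hausdorff_premeasure_antimono:
  assumes "\<delta> \<le> \<epsilon>"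
  shows "hausdorff_premeasure m s \<epsilon> S \<le> hausdorff_premeasure m s \<delta> S"
  unfolding hausdorff_premeasure_def using assms
  by (intro INF_superset_mono) (auto intro: order_trans ennreal_leI)

lemma hausdorff_measure_mono:
  "S \<subseteq> T \<Longrightarrow> hausdorff_measure m s S \<le> hausdorff_measure m s T"
  unfolding hausdorff_measure_def by (intro SUP_mono') (rule hausdorff_premeasure_mono)

text \<open>When the two sets are further apart than \<open>\<delta>\<close>, no set of a cover of diameter at most \<open>\<delta>\<close>
  meets both. The members of a cover of the union that meet \<open>S\<close>, and those that meet \<open>T\<close>, are therefore
  disjoint subfamilies, covering \<open>S\<close> and \<open>T\<close>.\<close>

lemma hausdorff_premeasure_separated:
  assumes sep: "\<And>x y. x \<in> S \<Longrightarrow> y \<in> T \<Longrightarrow> \<delta> < mdist m x y" and \<delta>: "0 < \<delta>"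
  shows "hausdorff_premeasure m s \<delta> S + hausdorff_premeasure m s \<delta> T
           \<le> hausdorff_premeasure m s \<delta> (S \<union> T)"
  unfolding hausdorff_premeasure_def [of m s \<delta> "S \<union> T"]
proof (rule INF_greatest)
  fix U assume U: "U \<in> {U :: nat \<Rightarrow> 'a set. S \<union> T \<subseteq> (\<Union>i. U i) \<and>
    (\<forall>i. U i \<subseteq> mspace m \<and> mdiam m (U i) \<le> ennreal \<delta>)}"
  \<comment> \<open>A subfamily is represented by emptying the other members, whose gauge is then \<open>0\<close>.\<close>
  define V where "V = (\<lambda>R i. if U i \<inter> R = {} then {} else U i)"
  have bound: "hausdorff_premeasure m s \<delta> R \<le> (\<Sum>i. hausdorff_gauge m s (V R i))"
    if R: "R \<subseteq> S \<union> T" for R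
    unfolding hausdorff_premeasure_def
  proof (rule INF_lower, safe)
    fix x assume "x \<in> R"
    then obtain i where "x \<in> U i" using U R by blast
    then have "x \<in> V R i" using \<open>x \<in> R\<close> by (auto simp: V_def)
    then show "x \<in> (\<Union>i. V R i)" by blast
  next
    fix i x assume "x \<in> V R i"
    then show "x \<in> mspace m" using U by (auto simp: V_def split: if_splits)
  next
    fix i show "mdiam m (V R i) \<le> ennreal \<delta>"
      using U by (auto simp: V_def) (simp add: mdiam_def)
  qed
  have "V S i = {} \<or> V T i = {}" for i
  proof (rule ccontr)
    assume "\<not> ?thesis"
    then obtain x y where xy: "x \<in> U i" "x \<in> S" "y \<in> U i" "y \<in> T"
      by (auto simp: V_def split: if_splits)
    then have "ennreal (mdist m x y) \<le> ennreal \<delta>"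
      using U by (auto simp: mdiam_le_iff)
    then show False using sep [OF xy(2,4)] \<delta> by (simp add: ennreal_le_iff)
  qed
  moreover have "V R i = {} \<or> V R i = U i" for R i by (simp add: V_def)
  ultimately have one: "hausdorff_gauge m s (V S i) + hausdorff_gauge m s (V T i)
      \<le> hausdorff_gauge m s (U i)" for i
    by (metis add.left_neutral add.right_neutral hausdorff_gauge_empty order_refl zero_le)
  have "hausdorff_premeasure m s \<delta> S + hausdorff_premeasure m s \<delta> T
      \<le> (\<Sum>i. hausdorff_gauge m s (V S i)) + (\<Sum>i. hausdorff_gauge m s (V T i))"
    by (intro add_mono bound) auto
  also have "\<dots> = (\<Sum>i. hausdorff_gauge m s (V S i) + hausdorff_gauge m s (V T i))"
    by (intro suminf_add) auto
  also have "\<dots> \<le> (\<Sum>i. hausdorff_gauge m s (U i))"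
    by (intro suminf_le one) auto
  finally show "hausdorff_premeasure m s \<delta> S + hausdorff_premeasure m s \<delta> T
      \<le> (\<Sum>i. hausdorff_gauge m s (U i))" .
qed

text \<open>Hausdorff measure is a metric outer measure: the premeasures at scales below \<open>\<eta>\<close> are superadditive on
  the two sets, and passing to smaller scales only increases them.\<close>

lemma hausdorff_measure_separated:
  assumes sep: "\<And>x y. x \<in> S \<Longrightarrow> y \<in> T \<Longrightarrow> \<eta> \<le> mdist m x y" and \<eta>: "0 < \<eta>"
  shows "hausdorff_measure m s S + hausdorff_measure m s T \<le> hausdorff_measure m s (S \<union> T)"
proof -
  have "hausdorff_measure m s S + hausdorff_measure m s T =
      (SUP \<delta>\<in>{0<..}. hausdorff_premeasure m s \<delta> S + hausdorff_premeasure m s \<delta> T)"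
    unfolding hausdorff_measure_def
  proof (rule SUP_add_directed_ennreal [symmetric])
    fix \<delta> \<epsilon> :: real assume "\<delta> \<in> {0<..}" "\<epsilon> \<in> {0<..}"
    then show "\<exists>\<gamma>\<in>{0<..}. hausdorff_premeasure m s \<delta> S + hausdorff_premeasure m s \<epsilon> T
        \<le> hausdorff_premeasure m s \<gamma> S + hausdorff_premeasure m s \<gamma> T"
      by (intro bexI [of _ "min \<delta> \<epsilon>"] add_mono hausdorff_premeasure_antimono) auto
  qed
  also have "\<dots> \<le> hausdorff_measure m s (S \<union> T)"
  proof (rule SUP_least)
    fix \<delta> :: real assume \<delta>: "\<delta> \<in> {0<..}"
    define \<gamma> where "\<gamma> = min \<delta> (\<eta> / 2)"
    have \<gamma>: "0 < \<gamma>" "\<gamma> < \<eta>" "\<gamma> \<le> \<delta>" using \<delta> \<eta> by (auto simp: \<gamma>_def)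
    have "hausdorff_premeasure m s \<delta> S + hausdorff_premeasure m s \<delta> T
        \<le> hausdorff_premeasure m s \<gamma> S + hausdorff_premeasure m s \<gamma> T"
      by (intro add_mono hausdorff_premeasure_antimono \<gamma>)
    also have "\<dots> \<le> hausdorff_premeasure m s \<gamma> (S \<union> T)"
      using sep \<gamma> by (intro hausdorff_premeasure_separated) force+
    also have "\<dots> \<le> hausdorff_measure m s (S \<union> T)"
      unfolding hausdorff_measure_def using \<gamma> by (intro SUP_upper) auto
    finally show "hausdorff_premeasure m s \<delta> S + hausdorff_premeasure m s \<delta> T
        \<le> hausdorff_measure m s (S \<union> T)" .
  qed
  finally show ?thesis .
qed

section \<open>Hausdorff measure of cubes\<close>

definition cube :: "nat \<Rightarrow> (nat \<Rightarrow> real) \<Rightarrow> real \<Rightarrow> (nat \<Rightarrow> real) set" where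
  "cube d q r = {x \<in> topspace (Euclidean_space d). \<forall>i<d. \<bar>x i - q i\<bar> \<le> r}"

lemma abs_diff_le_euclidean_dist:
  "i < d \<Longrightarrow> \<bar>x i - y i\<bar> \<le> mdist (euclidean_space_metric d) x y"
  using member_le_L2_set [of "{..<d}" i "\<lambda>i. \<bar>x i - y i\<bar>"]
  by (simp add: L2_set_def)

lemma hausdorff_gauge_le_power:
  assumes "0 < d" "0 \<le> r" and "\<And>x y. x \<in> U \<Longrightarrow> y \<in> U \<Longrightarrow> mdist m x y \<le> r"
  shows "hausdorff_gauge m (real d) U \<le> ennreal (r ^ d)"
proof (cases "U = {}")
  case False
  have "mdiam m U \<le> ennreal r" using assms(3) by (auto simp: mdiam_le_iff intro: ennreal_leI)
  then have "enn2real (mdiam m U) \<le> r" using assms(2) by (rule enn2real_leI [rotated])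
  then have "enn2real (mdiam m U) powr real d \<le> r powr real d"
    by (intro powr_mono2) auto
  also have "\<dots> = r ^ d" using assms(1,2) by (intro powr_realpow') auto
  finally show ?thesis using assms(1) False by (simp add: hausdorff_gauge_def ennreal_leI)
qed simp

text \<open>A grid of mesh \<open>2 / N\<close> covers the cube by \<open>(N + 1) ^ d\<close> cells of diameter at most \<open>2 d / N\<close>, so the
  gauges add up to at most \<open>((N + 1) / N * 2 d) ^ d \<le> (4 d) ^ d\<close>, whatever \<open>N\<close> is.\<close>

lemma hausdorff_measure_unit_cube_finite:
  assumes d: "0 < d"
  shows "hausdorff_measure (euclidean_space_metric d) (real d) (cube d (\<lambda>_. 0) 1) < \<infinity>"
proof -
  let ?E = "euclidean_space_metric d"
  have "hausdorff_premeasure ?E (real d) \<delta> (cube d (\<lambda>_. 0) 1) \<le> ennreal ((4 * real d) ^ d)"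
    if \<delta>: "\<delta> \<in> {0<..}" for \<delta>
  proof -
    obtain N :: nat where N: "2 * real d / \<delta> < real N"
      using reals_Archimedean2 by blast
    have N0: "0 < real N" using N \<delta> d by (meson divide_nonneg_pos greaterThan_iff le_less_trans mult_nonneg_nonneg of_nat_0_le_iff zero_le_numeral)
    \<comment> \<open>The index \<open>N\<close> is included so that the face \<open>x i = 1\<close>, where the floor below equals \<open>N\<close>, needs no separate treatment.\<close>
    define G where "G = ({..<d} \<rightarrow>\<^sub>E {..N})"
    define Q where "Q = (\<lambda>g :: nat \<Rightarrow> nat. {x \<in> topspace (Euclidean_space d).
      \<forall>i<d. 2 * real (g i) / real N \<le> x i + 1 \<and> x i + 1 \<le> 2 * (real (g i) + 1) / real N})"
    have finG: "finite G" and cardG: "card G = Suc N ^ d"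
      by (auto simp: G_def card_PiE intro!: finite_PiE)
    obtain e where e: "bij_betw e {0..<card G} G"
      using ex_bij_betw_nat_finite [OF finG] by auto
    define U where "U = (\<lambda>k. if k < card G then Q (e k) else {})"
    define r where "r = 2 * real d / real N"
    have r: "0 \<le> r" "r \<le> \<delta>"
      using N N0 \<delta> by (auto simp: r_def field_simps)
    have diam: "mdist ?E x y \<le> r" if "x \<in> Q g" "y \<in> Q g" for x y g
    proof -
      have "mdist ?E x y \<le> (\<Sum>i<d. \<bar>x i - y i\<bar>)"
        using L2_set_le_sum_abs by simp
      also have "\<dots> \<le> (\<Sum>i<d. 2 / real N)"
      proof (rule sum_mono)
        fix i assume "i \<in> {..<d}"
        then have "2 * real (g i) / real N \<le> x i + 1" "x i + 1 \<le> 2 * real (g i) / real N + 2 / real N"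
          "2 * real (g i) / real N \<le> y i + 1" "y i + 1 \<le> 2 * real (g i) / real N + 2 / real N"
          using that by (auto simp: Q_def distrib_left add_divide_distrib)
        then show "\<bar>x i - y i\<bar> \<le> 2 / real N" by linarith
      qed
      finally show ?thesis by (simp add: r_def mult.commute)
    qed
    have "hausdorff_premeasure ?E (real d) \<delta> (cube d (\<lambda>_. 0) 1) \<le> (\<Sum>k. hausdorff_gauge ?E (real d) (U k))"
      unfolding hausdorff_premeasure_def
    proof (rule INF_lower, safe)
      fix x assume x: "x \<in> cube d (\<lambda>_. 0) 1"
      define g where "g = (\<lambda>i\<in>{..<d}. nat \<lfloor>(x i + 1) * real N / 2\<rfloor>)"
      have g: "real (g i) \<le> (x i + 1) * real N / 2" "(x i + 1) * real N / 2 \<le> real (g i) + 1"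
        "g i \<le> N" if "i < d" for i
      proof -
        have xi: "\<bar>x i\<bar> \<le> 1" using x that by (auto simp: cube_def)
        then have pos: "0 \<le> (x i + 1) * real N / 2" by simp
        have gi: "g i = nat \<lfloor>(x i + 1) * real N / 2\<rfloor>" using that by (simp add: g_def)
        show 1: "real (g i) \<le> (x i + 1) * real N / 2" "(x i + 1) * real N / 2 \<le> real (g i) + 1"
          unfolding gi using pos by linarith+
        have "(x i + 1) * real N / 2 \<le> real N" using xi N0 by (simp add: field_simps)
        with 1(1) show "g i \<le> N" by linarith
      qed
      have "g \<in> G" using g(3) by (auto simp: G_def g_def)
      then obtain k where k: "k < card G" "e k = g"
        using e unfolding bij_betw_def by (metis atLeastLessThan_iff imageE)
      have "x \<in> Q g" using x g N0 by (auto simp: Q_def cube_def field_simps)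
      then have "x \<in> U k" using k by (simp add: U_def)
      then show "x \<in> (\<Union>k. U k)" by blast
    next
      fix k x assume "x \<in> U k"
      then show "x \<in> mspace ?E" by (auto simp: U_def Q_def split: if_splits)
    next
      fix k show "mdiam ?E (U k) \<le> ennreal \<delta>"
        unfolding mdiam_le_iff
        using diam r by (auto simp: U_def intro!: ennreal_leI intro: order_trans simp del: mdist_euclidean_space_metric)
    qed
    also have "\<dots> = (\<Sum>k<card G. hausdorff_gauge ?E (real d) (U k))"
      by (intro suminf_finite) (auto simp: U_def)
    also have "\<dots> \<le> (\<Sum>k<card G. ennreal (r ^ d))"
      using diam r d by (intro sum_mono hausdorff_gauge_le_power) (auto simp: U_def simp del: mdist_euclidean_space_metric)
    also have "\<dots> = ennreal (real (card G) * r ^ d)"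
      using r by (simp add: ennreal_mult'' ennreal_of_nat_eq_real_of_nat)
    also have "real (card G) * r ^ d = ((real N + 1) / real N * (2 * real d)) ^ d"
      by (simp add: cardG r_def power_mult_distrib power_divide add.commute)
    also have "ennreal \<dots> \<le> ennreal ((4 * real d) ^ d)"
    proof (intro ennreal_leI power_mono)
      have "(real N + 1) / real N \<le> 2" using N0 by (simp add: field_simps)
      then show "(real N + 1) / real N * (2 * real d) \<le> 4 * real d"
        using mult_right_mono [of "(real N + 1) / real N" 2 "2 * real d"] by simp
    qed simp
    finally show ?thesis .
  qed
  then have "hausdorff_measure ?E (real d) (cube d (\<lambda>_. 0) 1) \<le> ennreal ((4 * real d) ^ d)"
    unfolding hausdorff_measure_def by (rule SUP_least)
  then show ?thesis by (rule le_less_trans) simp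
qed

text \<open>A set of diameter \<open>r\<close> lies in the box of side \<open>2 r\<close> centred at any of its points. This compares
  the gauge with Lebesgue measure. The product measure lives on functions that are \<^const>\<open>undefined\<close>
  outside \<open>{..<d}\<close>, whereas points of the Euclidean space vanish there, hence the restriction.\<close>

lemma ex_box_emeasure_le_hausdorff_gauge:
  fixes U :: "(nat \<Rightarrow> real) set"
  assumes d: "0 < d" and fin: "mdiam (euclidean_space_metric d) U \<noteq> \<infinity>"
  shows "\<exists>B\<in>sets (\<Pi>\<^sub>M i\<in>{..<d}. lborel). (\<lambda>x. restrict x {..<d}) ` U \<subseteq> B \<and>
    emeasure (\<Pi>\<^sub>M i\<in>{..<d}. lborel) B \<le> 2 ^ d * hausdorff_gauge (euclidean_space_metric d) (real d) U"
proof (cases "U = {}")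
  case False
  interpret product_sigma_finite "\<lambda>_::nat. lborel :: real measure" by unfold_locales
  let ?E = "euclidean_space_metric d"
  obtain q where q: "q \<in> U" using False by auto
  define r where "r = enn2real (mdiam ?E U)"
  have r: "mdiam ?E U = ennreal r" "0 \<le> r" using fin by (auto simp: r_def less_top)
  define B where "B = (\<Pi>\<^sub>E i\<in>{..<d}. {q i - r..q i + r})"
  have "x \<in> U \<Longrightarrow> restrict x {..<d} \<in> B" for x
  proof -
    assume x: "x \<in> U"
    have "mdist ?E x q \<le> r"
      using mdiam_le_iff [of ?E U "ennreal r"] r x q by (auto simp: ennreal_le_iff simp del: mdist_euclidean_space_metric)
    then have "\<bar>x i - q i\<bar> \<le> r" if "i < d" for i
      using abs_diff_le_euclidean_dist [OF that] order_trans by blast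
    then show "restrict x {..<d} \<in> B" by (fastforce simp: B_def abs_le_iff)
  qed
  moreover have "B \<in> sets (\<Pi>\<^sub>M i\<in>{..<d}. lborel)"
    unfolding B_def by (intro sets_PiM_I_finite) auto
  moreover have "emeasure (\<Pi>\<^sub>M i\<in>{..<d}. lborel) B = (\<Prod>i<d. ennreal (2 * r))"
    unfolding B_def using r(2) by (subst emeasure_PiM) auto
  moreover have "(\<Prod>i<d. ennreal (2 * r)) = 2 ^ d * ennreal (r ^ d)"
    using r(2) by (simp add: ennreal_mult power_mult_distrib ennreal_power)
  moreover have "hausdorff_gauge ?E (real d) U = ennreal (r ^ d)"
    using d False r(2) by (simp add: hausdorff_gauge_def r_def powr_realpow')
  ultimately show ?thesis by (intro bexI [of _ B]) auto
qed (auto intro!: bexI [of _ "{}"])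

text \<open>Lebesgue measure is countably subadditive, so by the comparison with boxes every cover of the cube has
  total gauge at least \<open>2 ^ (- d)\<close> times its volume.\<close>

lemma hausdorff_measure_cube_pos:
  assumes d: "0 < d" and r: "0 < r"
  shows "0 < hausdorff_measure (euclidean_space_metric d) (real d) (cube d q r)"
proof -
  interpret product_sigma_finite "\<lambda>_::nat. lborel :: real measure" by unfold_locales
  let ?E = "euclidean_space_metric d" and ?M = "\<Pi>\<^sub>M i\<in>{..<d}. (lborel :: real measure)"
  define Q where "Q = (\<Pi>\<^sub>E i\<in>{..<d}. {q i - r..q i + r})"
  have Q: "Q \<subseteq> (\<lambda>x. restrict x {..<d}) ` cube d q r"
  proof
    fix y assume y: "y \<in> Q"
    define x where "x = (\<lambda>i. if i < d then y i else 0)"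
    have "y i \<in> {q i - r..q i + r}" if "i < d" for i
      using PiE_mem [of y "{..<d}"] y that unfolding Q_def by blast
    then have "\<bar>x i - q i\<bar> \<le> r" if "i < d" for i
      using that by (auto simp: x_def abs_le_iff algebra_simps)
    then have "x \<in> cube d q r"
      unfolding cube_def topspace_Euclidean_space by (auto simp: x_def)
    moreover have "y = restrict x {..<d}"
    proof
      fix i show "y i = restrict x {..<d} i"
        using PiE_arb [OF y [unfolded Q_def], of i] by (cases "i < d") (simp_all add: x_def)
    qed
    ultimately show "y \<in> (\<lambda>x. restrict x {..<d}) ` cube d q r" by blast
  qed
  have "emeasure ?M Q = (\<Prod>i<d. ennreal (2 * r))"
    unfolding Q_def using r by (subst emeasure_PiM) auto
  then have posQ: "emeasure ?M Q \<noteq> 0" using r by (simp add: prod_zero_iff)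
  \<comment> \<open>The bound holds at every scale; scale \<open>1\<close> suffices, and it makes all diameters finite.\<close>
  have "emeasure ?M Q / 2 ^ d \<le> hausdorff_premeasure ?E (real d) 1 (cube d q r)"
    unfolding hausdorff_premeasure_def
  proof (rule INF_greatest)
    fix U :: "nat \<Rightarrow> (nat \<Rightarrow> real) set"
    assume "U \<in> {U. cube d q r \<subseteq> (\<Union>i. U i) \<and>
      (\<forall>i. U i \<subseteq> mspace ?E \<and> mdiam ?E (U i) \<le> ennreal 1)}"
    then have cover: "cube d q r \<subseteq> (\<Union>i. U i)" and diam: "\<forall>i. mdiam ?E (U i) \<le> ennreal 1"
      by blast+
    have fin: "mdiam ?E (U i) \<noteq> \<infinity>" for i
    proof
      assume "mdiam ?E (U i) = \<infinity>"
      then have "\<infinity> \<le> ennreal 1" using diam by metis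
      then show False by (simp add: top_unique)
    qed
    obtain B where B: "B i \<in> sets ?M" "(\<lambda>x. restrict x {..<d}) ` U i \<subseteq> B i"
      "emeasure ?M (B i) \<le> 2 ^ d * hausdorff_gauge ?E (real d) (U i)" for i
      using ex_box_emeasure_le_hausdorff_gauge [OF d fin] by metis
    have "Q \<subseteq> (\<Union>i. B i)"
    proof
      fix y assume "y \<in> Q"
      then obtain x where "x \<in> cube d q r" "y = restrict x {..<d}" using Q by blast
      moreover from this obtain i where "x \<in> U i" using cover by blast
      ultimately have "y \<in> B i" using B(2) by blast
      then show "y \<in> (\<Union>i. B i)" by blast
    qed
    then have "emeasure ?M Q \<le> emeasure ?M (\<Union>i. B i)"
      using B(1) by (intro emeasure_mono) auto
    also have "\<dots> \<le> (\<Sum>i. emeasure ?M (B i))"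
      using B(1) by (intro emeasure_subadditive_countably) auto
    also have "\<dots> \<le> (\<Sum>i. 2 ^ d * hausdorff_gauge ?E (real d) (U i))"
      by (intro suminf_le B(3)) auto
    also have "\<dots> = 2 ^ d * (\<Sum>i. hausdorff_gauge ?E (real d) (U i))"
      by (rule ennreal_suminf_cmult)
    finally have "emeasure ?M Q \<le> 2 ^ d * (\<Sum>i. hausdorff_gauge ?E (real d) (U i))" .
    moreover have "0 < (2 :: ennreal) ^ d"
      unfolding zero_less_iff_neq_zero by (rule power_not_zero) simp
    ultimately show "emeasure ?M Q / 2 ^ d \<le> (\<Sum>i. hausdorff_gauge ?E (real d) (U i))"
      by (rule divide_le_posI_ennreal [rotated])
  qed
  also have "\<dots> \<le> hausdorff_measure ?E (real d) (cube d q r)"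
    unfolding hausdorff_measure_def by (intro SUP_upper) auto
  finally have le: "emeasure ?M Q / 2 ^ d \<le> hausdorff_measure ?E (real d) (cube d q r)" .
  have "0 < emeasure ?M Q / 2 ^ d"
    unfolding zero_less_iff_neq_zero using posQ
    by (simp add: ennreal_divide_eq_0_iff power_eq_top_ennreal)
  then show ?thesis using le by (rule less_le_trans)
qed

section \<open>The projected cone has larger measure in the unit ball\<close>

theorem theorem5p5:
  fixes n k :: nat
  assumes "n \<ge> 1" and "k \<ge> 1" and "k \<ge> 2 * n"
  shows "hausdorff_measure (euclidean_space_metric (k + 1)) (real (k + 1))
           (coeff ` drop_term (k + 1) ` nonneg_preserving_deg n (k + 1)
              \<inter> mcball_of (euclidean_space_metric (k + 1)) (\<lambda>_. 0) 1)
       > hausdorff_measure (euclidean_space_metric (k + 1)) (real (k + 1))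
           (coeff ` nonneg_preserving_deg n k
              \<inter> mcball_of (euclidean_space_metric (k + 1)) (\<lambda>_. 0) 1)"
proof -
  define d where "d = k + 1"
  \<comment> \<open>The lowest of the top \<open>n\<close> exponents in degree \<open>k\<close>, which in degree \<open>k + 1\<close> has \<open>n\<close> exponents above it.\<close>
  define m where "m = k + 1 - n"
  let ?H = "hausdorff_measure (euclidean_space_metric d) (real d)"
  let ?B = "mcball_of (euclidean_space_metric d) (\<lambda>_. 0) 1"
  define P where "P = coeff ` nonneg_preserving_deg n k \<inter> ?B"
  define R where "R = coeff ` drop_term (k + 1) ` nonneg_preserving_deg n (k + 1) \<inter> ?B"
  have m: "n \<le> m" "m + n = k + 1" "m \<le> k" using assms by (auto simp: m_def)
  \<comment> \<open>Points of the cube below have coordinates at most \<open>3 * b = 1 / d\<close> in absolute value, which puts them in the unit ball.\<close>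
  define b where "b = 1 / (3 * real d)"
  \<comment> \<open>Coordinate \<open>m\<close> ranges over \<open>{- 3 * \<eta>..- \<eta>}\<close>, so \<open>3 * \<eta> * n ^ m\<close> must not exceed \<open>2 * b\<close>.\<close>
  define \<eta> where "\<eta> = b / (3 * real n ^ m)"
  have b: "0 < b" by (simp add: b_def d_def)
  have n1: "1 \<le> real n ^ m" using assms(1) by simp
  have "0 < real n ^ m" using n1 by linarith
  then have \<eta>: "0 < \<eta>" using b by (simp add: \<eta>_def)
  have "b * 1 \<le> b * (3 * real n ^ m)" using b n1 by (intro mult_left_mono) auto
  then have \<eta>_le: "\<eta> \<le> b" using \<open>0 < real n ^ m\<close> by (simp add: \<eta>_def divide_le_eq)
  define q where "q = (\<lambda>i. if i = m then - 2 * \<eta> else 2 * b)"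
  define K where "K = cube d q \<eta>"
  have K: "- 3 * \<eta> \<le> x m" "x m \<le> - \<eta>" "\<And>i. i < d \<Longrightarrow> i \<noteq> m \<Longrightarrow> b \<le> x i"
      "\<And>i. i < d \<Longrightarrow> \<bar>x i\<bar> \<le> 3 * b" "\<And>i. d \<le> i \<Longrightarrow> x i = 0" if "x \<in> K" for x
  proof -
    have x: "\<bar>x i - q i\<bar> \<le> \<eta>" if "i < d" for i
      using that \<open>x \<in> K\<close> by (auto simp: K_def cube_def)
    have "m < d" using m by (simp add: d_def)
    from x [OF this] show xm: "- 3 * \<eta> \<le> x m" "x m \<le> - \<eta>" by (auto simp: q_def abs_le_iff)
    show low: "b \<le> x i" if "i < d" "i \<noteq> m" for i
      using x [OF that(1)] that(2) \<eta>_le by (auto simp: q_def abs_le_iff)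
    show "\<bar>x i\<bar> \<le> 3 * b" if "i < d" for i
      using x [OF that] xm \<eta>_le b by (cases "i = m") (auto simp: q_def abs_le_iff)
    show "x i = 0" if "d \<le> i" for i
      using \<open>x \<in> K\<close> that by (auto simp: K_def cube_def topspace_Euclidean_space)
  qed
  have K_ball: "K \<subseteq> ?B"
  proof
    fix x assume x: "x \<in> K"
    have "(\<Sum>i<d. (x i)\<^sup>2) \<le> (\<Sum>i<d. (3 * b)\<^sup>2)"
      using K(4) [OF x] by (intro sum_mono abs_le_square_iff [THEN iffD1]) (use b in auto)
    also have "\<dots> = real d * (3 * b)\<^sup>2" by simp
    also have "\<dots> = 1 / real d" by (simp add: b_def power2_eq_square)
    also have "\<dots> \<le> 1" by (simp add: d_def)
    finally have "L2_set (\<lambda>i. - x i) {..<d} \<le> 1" by (simp add: L2_set_def)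
    then show "x \<in> ?B" using K(5) [OF x] by (simp add: topspace_Euclidean_space)
  qed
  have K_proj: "K \<subseteq> coeff ` drop_term (k + 1) ` nonneg_preserving_deg n (k + 1)"
  proof
    fix x assume x: "x \<in> K"
    \<comment> \<open>The dropped coefficient is free, and \<open>b\<close> is the least value allowed to compensate for coefficient \<open>m\<close>.\<close>
    define p where "p = (\<Sum>i\<le>k. monom (x i) i) + monom b (k + 1)"
    have coeff_sum: "coeff (\<Sum>i\<le>k. monom (x i) i) l = (if l \<le> k then x l else 0)" for l
      by (simp add: coeff_sum coeff_monom)
    have coeff_p: "coeff p l = (if l = k + 1 then b else x l)" for l
      using K(5) [OF x, of l] by (auto simp: p_def coeff_sum coeff_monom d_def)
    have deg: "degree p \<le> k + 1"
      using K(5) [OF x] by (intro degree_le) (auto simp: coeff_p d_def)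
    have "- 2 * b \<le> (- 3 * \<eta>) * real n ^ m" using n1 b by (simp add: \<eta>_def)
    also have "\<dots> \<le> x m * real n ^ m" using K(1) [OF x] n1 by (intro mult_right_mono) auto
    finally have "- 2 * b \<le> coeff p m * real n ^ m" using m by (simp add: coeff_p)
    moreover have "b \<le> coeff p l" if "l \<le> m + n" "l \<noteq> m" for l
      using K(3) [OF x, of l] that m by (auto simp: coeff_p d_def)
    ultimately have "p \<in> nonneg_preserving n"
      using deg m b by (intro nonneg_preserving_with_negative_coeff [where b = b and m = m]) auto
    then have "p \<in> nonneg_preserving_deg n (k + 1)" using deg by (simp add: nonneg_preserving_deg_def)
    moreover have "x = coeff (drop_term (k + 1) p)"
      using K(5) [OF x, of "k + 1"] by (auto simp: fun_eq_iff drop_term_def coeff_p coeff_monom d_def)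
    ultimately show "x \<in> coeff ` drop_term (k + 1) ` nonneg_preserving_deg n (k + 1)" by blast
  qed
  have P_sub: "P \<subseteq> R"
  proof
    fix x assume "x \<in> P"
    then obtain p where p: "p \<in> nonneg_preserving_deg n k" "x = coeff p" "x \<in> ?B"
      by (auto simp: P_def)
    have "p \<in> nonneg_preserving_deg n (k + 1)" "drop_term (k + 1) p = p"
      using p(1) by (auto simp: nonneg_preserving_deg_def drop_term_def coeff_eq_0)
    then show "x \<in> R" using p(2,3) unfolding R_def by (metis IntI image_eqI)
  qed
  have sep: "\<eta> \<le> mdist (euclidean_space_metric d) x y" if "x \<in> P" "y \<in> K" for x y
  proof -
    have "0 \<le> x m"
      using that(1) coeff_nonneg_if_nonneg_preserving [of n _ k m] assms(1) m
      by (auto simp: P_def nonneg_preserving_deg_def)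
    then have "\<eta> \<le> \<bar>x m - y m\<bar>" using K(2) [OF that(2)] by linarith
    also have "\<dots> \<le> mdist (euclidean_space_metric d) x y"
      using m by (intro abs_diff_le_euclidean_dist) (simp add: d_def)
    finally show ?thesis .
  qed
  have "P \<subseteq> cube d (\<lambda>_. 0) 1"
  proof
    fix x assume "x \<in> P"
    then have x: "x \<in> ?B" by (simp add: P_def)
    have "\<bar>x i - 0\<bar> \<le> 1" if "i < d" for i
    proof -
      have "\<bar>0 - x i\<bar> \<le> mdist (euclidean_space_metric d) (\<lambda>_. 0) x"
        by (rule abs_diff_le_euclidean_dist [OF that])
      also have "\<dots> \<le> 1" using x by simp
      finally show ?thesis by simp
    qed
    then show "x \<in> cube d (\<lambda>_. 0) 1" using x by (auto simp: cube_def)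
  qed
  then have "?H P < \<infinity>"
    using hausdorff_measure_mono hausdorff_measure_unit_cube_finite [of d]
    by (metis Suc_eq_plus1 d_def le_less_trans zero_less_Suc)
  moreover have "0 < ?H K"
    unfolding K_def using \<eta> by (intro hausdorff_measure_cube_pos) (auto simp: d_def)
  ultimately have "?H P < ?H P + ?H K"
    by (metis add.right_neutral ennreal_add_left_cancel_less infinity_ennreal_def less_irrefl)
  also have "\<dots> \<le> ?H (P \<union> K)"
    using sep \<eta> by (rule hausdorff_measure_separated)
  also have "\<dots> \<le> ?H R"
    using P_sub K_ball K_proj by (intro hausdorff_measure_mono) (auto simp: R_def)
  finally show ?thesis by (simp add: P_def R_def d_def)
qed

end
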